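(* Let $l\in\mathbb{R}$ be known, $n_0>0$ and $w_0>0$. Let $X=(x_1,\dots,x_n)$, $n\ge1$, be observations with $x_i>l$ that are i.i.d. given a width $w>0$, each uniformly distributed on $(l,l+w)$. Suppose $w$ has prior distribution $\mathrm{Pareto}(n_0,w_0)$. Then the posterior distribution of $w$ given $X$ is $$p(w\mid X)=\mathrm{Pareto}\big(w\mid n+n_0,\ w_n\big),\qquad w_n=\max\Big(w_0,\ \max_{1\le i\le n}x_i-l\Big).$$ In particular the Pareto family is a conjugate prior family for the width $w$ of the uniform distribution $U(l,l+w)$ with known $l$.
   Context: For $a,b>0$, $\mathrm{Pareto}(y\mid a,b)=\frac{a b^{a}}{y^{a+1}}$ for $y>b$ and $0$ otherwise. The posterior density is $p(w\mid X)=p(X\mid w)p(w)\big/\int p(X\mid w)p(w)\,dw$ with $p(X\mid w)=\prod_i p(x_i\mid w)$ and $p(x_i\mid w)=w^{-1}$ for $l<x_i<l+w$, $0$ otherwise; densities are identified when they agree almost everywhere. A prior is conjugate for a sampling distribution if the posterior belongs to the same parametric family as the prior. *)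

theory Defs
  imports "HOL-Probability.Probability"
begin

definition pareto_density :: "real \<Rightarrow> real \<Rightarrow> real \<Rightarrow> real" where
  "pareto_density a b y = (if y > b then a * b powr a / y powr (a + 1) else 0)"

text \<open>Density of the uniform distribution on the interval from \<open>l\<close> to \<open>l + w\<close>;
  it vanishes identically for \<open>w \<le> 0\<close>, so integrals over the width may range over all reals.\<close>

definition uniform_width_density :: "real \<Rightarrow> real \<Rightarrow> real \<Rightarrow> real" where
  "uniform_width_density l x w = (if l < x \<and> x < l + w then inverse w else 0)"

lemma uniform_width_density_eq_uniform_measure:
  assumes "w > 0"
  shows "density lborel (\<lambda>x. ennreal (uniform_width_density l x w))
    = uniform_measure lborel {l<..<l + w}"
proof -
  have "ennreal (uniform_width_density l x w)
      = indicator {l<..<l + w} x / emeasure lborel {l<..<l + w}" for x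
    using assms by (auto simp: uniform_width_density_def indicator_def divide_ennreal
        inverse_eq_divide simp flip: ennreal_1)
  then show ?thesis
    by (simp add: uniform_measure_def)
qed

text \<open>Here \<open>p x w\<close> is the sampling density of one observation \<open>x\<close> given the parameter \<open>w\<close>,
  and the sample consists of \<open>x 1, \<dots>, x n\<close>.\<close>

definition likelihood :: "('x \<Rightarrow> real \<Rightarrow> real) \<Rightarrow> nat \<Rightarrow> (nat \<Rightarrow> 'x) \<Rightarrow> real \<Rightarrow> real" where
  "likelihood p n x w = (\<Prod>i=1..n. p (x i) w)"

text \<open>If the normalising integral is zero or does not exist, this function is identically \<open>0\<close>;
  hence its almost-everywhere equality with a probability density also says that the
  normalising integral exists and is nonzero.\<close>

definition posterior_density ::
  "('x \<Rightarrow> real \<Rightarrow> real) \<Rightarrow> nat \<Rightarrow> (nat \<Rightarrow> 'x) \<Rightarrow> (real \<Rightarrow> real) \<Rightarrow> real \<Rightarrow> real" where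
  "posterior_density p n x prior w =
    likelihood p n x w * prior w / (\<integral>v. likelihood p n x v * prior v \<partial>lborel)"

definition prob_density :: "(real \<Rightarrow> real) \<Rightarrow> bool" where
  "prob_density f \<longleftrightarrow> f \<in> borel_measurable borel \<and> (\<forall>w. 0 \<le> f w) \<and>
    prob_space (density lborel (\<lambda>w. ennreal (f w)))"

text \<open>\<open>S\<close> is the set of possible values of an observation, and \<open>f \<theta>\<close>, for \<open>\<theta> \<in> \<Theta>\<close>, is the
  parametric family of prior densities.\<close>

definition conjugate_prior_family ::
  "'x set \<Rightarrow> ('x \<Rightarrow> real \<Rightarrow> real) \<Rightarrow> 'p set \<Rightarrow> ('p \<Rightarrow> real \<Rightarrow> real) \<Rightarrow> bool" where
  "conjugate_prior_family S p \<Theta> f \<longleftrightarrow>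
    (\<forall>\<theta>\<in>\<Theta>. prob_density (f \<theta>)) \<and>
    (\<forall>\<theta>\<in>\<Theta>. \<forall>n\<ge>1. \<forall>x. (\<forall>i\<in>{1..n}. x i \<in> S) \<longrightarrow>
      (\<exists>\<theta>'\<in>\<Theta>. AE w in lborel. posterior_density p n x (f \<theta>) w = f \<theta>' w))"

end

theory Submission
  imports Defs
begin

text \<open>As a function of the width, likelihood times prior vanishes unless \<open>w\<close> exceeds both
  \<open>w\<^sub>0\<close> and every \<open>x i - l\<close>, and is otherwise a multiple of \<open>w powr - (n + n\<^sub>0 + 1)\<close>.  It is
  therefore a constant times a Pareto density; since the latter has integral 1, normalisation
  removes the constant.\<close>

lemma pareto_density_measurable [measurable]: "pareto_density a b \<in> borel_measurable borel"
  unfolding pareto_density_def by measurable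

lemma pareto_density_nonneg: "0 \<le> a \<Longrightarrow> 0 \<le> pareto_density a b y"
  by (simp add: pareto_density_def)

lemma nn_integral_pareto_density:
  assumes "0 < a" and "0 < b"
  shows "(\<integral>\<^sup>+ y. ennreal (pareto_density a b y) \<partial>lborel) = 1"
proof -
  let ?f = "\<lambda>y. a * b powr a / y powr (a + 1)"
  \<comment> \<open>On y > 0 this antiderivative is -(b/y)^a: it equals -1 at b and tends to 0 at
    infinity because a > 0, so the total mass is 1.\<close>
  let ?F = "\<lambda>y. - (b powr a) * y powr (- a)"
  have "(\<integral>\<^sup>+ y. ennreal (pareto_density a b y) \<partial>lborel)
      = (\<integral>\<^sup>+ y. ennreal (?f y) * indicator {b..} y \<partial>lborel)"
  proof (rule nn_integral_cong_AE)
    show "AE y in lborel. ennreal (pareto_density a b y) = ennreal (?f y) * indicator {b..} y"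
      using AE_lborel_singleton[of b]
      by eventually_elim (auto simp: pareto_density_def indicator_def)
  qed
  also have "\<dots> = ennreal (0 - ?F b)"
  proof (rule nn_integral_FTC_atLeast[where F = ?F])
    show "DERIV ?F y :> ?f y" if "b \<le> y" for y
      using that assms
      by (auto intro!: derivative_eq_intros simp: powr_diff powr_minus powr_add field_simps)
    have "((\<lambda>y::real. y powr (- a)) \<longlongrightarrow> 0) at_top"
      using assms by (intro tendsto_neg_powr filterlim_ident) auto
    then show "(?F \<longlongrightarrow> 0) at_top"
      by (rule tendsto_mult_right_zero)
  qed (use assms in auto)
  also have "0 - ?F b = 1"
    using assms by (simp add: powr_minus)
  finally show ?thesis
    by simp
qed

lemma integral_pareto_density:
  assumes "0 < a" and "0 < b"
  shows "(\<integral>y. pareto_density a b y \<partial>lborel) = 1"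
  using assms
  by (subst integral_eq_nn_integral) (simp_all add: nn_integral_pareto_density pareto_density_nonneg)

lemma prob_density_pareto_density:
  assumes "0 < a" and "0 < b"
  shows "prob_density (pareto_density a b)"
  unfolding prob_density_def
  using assms
  by (auto simp: pareto_density_nonneg emeasure_density nn_integral_pareto_density
      intro!: prob_spaceI)

text \<open>The factorisation holds at every v, so the normalising integral is c times the integral
  of \<open>g\<close>, that is c itself, and it cancels in the quotient.\<close>

lemma posterior_density_eqI:
  assumes "\<And>v. likelihood p n x v * prior v = c * g v"
    and "c \<noteq> 0" and "(\<integral>v. g v \<partial>lborel) = 1"
  shows "posterior_density p n x prior w = g w"
  using assms by (simp add: posterior_density_def)

text \<open>Since x i > l, a factor can vanish through its upper bound only, and the largest
  observation decides whether one does. The threshold is positive, so nonpositive widths fall into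
  the zero branch.\<close>

lemma likelihood_uniform_width:
  assumes "n \<ge> 1" and "\<And>i. i \<in> {1..n} \<Longrightarrow> x i > l"
  shows "likelihood (uniform_width_density l) n x w
    = (if w > Max (x ` {1..n}) - l then inverse w ^ n else 0)"
proof -
  \<comment> \<open>Here n \<ge> 1 makes the image nonempty, so that \<open>Max\<close> is a genuine
    maximum.\<close>
  have Max_less: "w > Max (x ` {1..n}) - l \<longleftrightarrow> (\<forall>i\<in>{1..n}. x i < l + w)"
    using assms(1) by (simp add: diff_less_eq add.commute)
  show ?thesis
  proof (cases "\<forall>i\<in>{1..n}. x i < l + w")
    case True
    then have "likelihood (uniform_width_density l) n x w = (\<Prod>i=1..n. inverse w)"
      unfolding likelihood_def using assms(2)
      by (intro prod.cong) (auto simp: uniform_width_density_def)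
    then show ?thesis
      using True Max_less by simp
  next
    case False
    then have "likelihood (uniform_width_density l) n x w = 0"
      unfolding likelihood_def
      by (auto simp: uniform_width_density_def intro!: prod_zero)
    then show ?thesis
      using False by (simp only: Max_less if_False)
  qed
qed

lemma posterior_density_uniform_width_pareto:
  assumes "a > 0" and "b > 0" and "n \<ge> 1"
    and "\<And>i. i \<in> {1..n} \<Longrightarrow> x i > l"
  shows "posterior_density (uniform_width_density l) n x (pareto_density a b) w
    = pareto_density (real n + a) (max b (Max (x ` {1..n}) - l)) w"
proof (rule posterior_density_eqI)
  let ?m = "Max (x ` {1..n}) - l"
  let ?b = "max b ?m"
  \<comment> \<open>The ratio of the leading constants of the prior and of the claimed
    posterior.\<close>
  let ?c = "(a * b powr a) / ((real n + a) * ?b powr (real n + a))"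
  have likelihood: "likelihood (uniform_width_density l) n x v
      = (if v > ?m then inverse v ^ n else 0)" for v
    using assms(3,4) by (rule likelihood_uniform_width)
  have "?b > 0"
    using assms(2) by simp
  then show "?c \<noteq> 0"
    using assms(1,2) by simp
  show "(\<integral>v. pareto_density (real n + a) ?b v \<partial>lborel) = 1"
    using assms(1) \<open>?b > 0\<close> by (intro integral_pareto_density) auto
  show "likelihood (uniform_width_density l) n x v * pareto_density a b v
      = ?c * pareto_density (real n + a) ?b v" for v
  proof (cases "v > ?b")
    case True
    then have "v > 0" "v > b" "v > ?m"
      using assms(2) by auto
    \<comment> \<open>The n likelihood factors 1/v raise the exponent of the prior from a + 1 to n +
      a + 1.\<close>
    have "v powr (real n + a + 1) = v ^ n * v powr (a + 1)"
      using \<open>v > 0\<close> by (simp add: powr_add powr_realpow)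
    then have "inverse v ^ n * (a * b powr a / v powr (a + 1))
        = a * b powr a / v powr (real n + a + 1)"
      by (simp add: field_simps)
    also have "\<dots> = ?c * ((real n + a) * ?b powr (real n + a) / v powr (real n + a + 1))"
      using \<open>?b > 0\<close> assms(1) by simp
    finally show ?thesis
      using True \<open>v > b\<close> \<open>v > ?m\<close>
      by (simp only: likelihood pareto_density_def if_True)
  next
    \<comment> \<open>Below or at the maximum, either v \<le> b and the prior vanishes, or v \<le>
      \<open>?m\<close> and the likelihood vanishes.\<close>
    case False
    then show ?thesis
      by (auto simp: likelihood pareto_density_def simp del: One_nat_def)
  qed
qed

lemma conjugate_prior_family_uniform_width_pareto:
  "conjugate_prior_family {l<..} (uniform_width_density l)
    ({0<..} \<times> {0<..}) (\<lambda>(a, b). pareto_density a b)"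
  unfolding conjugate_prior_family_def
proof (intro conjI ballI allI impI)
  fix \<theta> :: "real \<times> real"
  assume "\<theta> \<in> {0<..} \<times> {0<..}"
  then obtain a b where \<theta>: "\<theta> = (a, b)" and "a > 0" "b > 0"
    by auto
  show "prob_density (case \<theta> of (a, b) \<Rightarrow> pareto_density a b)"
    using \<open>a > 0\<close> \<open>b > 0\<close> by (simp add: \<theta> prob_density_pareto_density)
  fix n :: nat and x :: "nat \<Rightarrow> real"
  assume "n \<ge> 1" and "\<forall>i\<in>{1..n}. x i \<in> {l<..}"
  then have "posterior_density (uniform_width_density l) n x (pareto_density a b) w
      = pareto_density (real n + a) (max b (Max (x ` {1..n}) - l)) w" for w
    using \<open>a > 0\<close> \<open>b > 0\<close> by (intro posterior_density_uniform_width_pareto) auto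
  then show "\<exists>\<theta>'\<in>{0<..} \<times> {0<..}. AE w in lborel.
      posterior_density (uniform_width_density l) n x (case \<theta> of (a, b) \<Rightarrow> pareto_density a b) w
        = (case \<theta>' of (a, b) \<Rightarrow> pareto_density a b) w"
    using \<open>a > 0\<close> \<open>b > 0\<close>
    \<comment> \<open>The updated parameters do not depend on w and remain positive, as the maximum
      is at least b > 0.\<close>
    by (intro bexI[of _ "(real n + a, max b (Max (x ` {1..n}) - l))"]) (auto simp: \<theta>)
qed

theorem mainTheorem5:
  fixes l n\<^sub>0 w\<^sub>0 :: real and n :: nat and x :: "nat \<Rightarrow> real"
  assumes "n\<^sub>0 > 0" and "w\<^sub>0 > 0" and "n \<ge> 1"
    and "\<And>i. i \<in> {1..n} \<Longrightarrow> x i > l"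
  shows "(AE w in lborel.
      posterior_density (uniform_width_density l) n x (pareto_density n\<^sub>0 w\<^sub>0) w
        = pareto_density (real n + n\<^sub>0) (max w\<^sub>0 (Max (x ` {1..n}) - l)) w)
    \<and> conjugate_prior_family {l<..} (uniform_width_density l)
        ({0<..} \<times> {0<..}) (\<lambda>(a, b). pareto_density a b)"
  using assms
  \<comment> \<open>The posterior identity holds at every w, hence almost everywhere.\<close>
  by (intro conjI conjugate_prior_family_uniform_width_pareto AE_I2
      posterior_density_uniform_width_pareto)

end
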